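(* Let $\mathbf p=(A,B,C,a,b,c)\in\mathbb R^6$ and let $(G,\mathbf p)$ be the framework of the ladder graph $G$ in $\mathbb R^1$ with these vertex positions. Assume all edges have non-zero length, i.e. $A,B,C$ are pairwise distinct, $a,b,c$ are pairwise distinct, and $A\ne a$, $B\ne b$, $C\ne c$. Let $\mathcal A=(C-A)(b-a)-(c-a)(B-A)$ and let $D(\mathbf p)$ be the discriminant defined in the context. Then: 1. If $D(\mathbf p)>0$, then $(G,\mathbf p)$ is super stable in $\mathbb R^1$. 2. If $D(\mathbf p)<0$, then $(G,\mathbf p)$ is not universally rigid. 3. If $D(\mathbf p)=0$ and $\mathcal A\neq 0$, then $(G,\mathbf p)$ is universally rigid, but not super stable. 4. If $D(\mathbf p)=0$ and $\mathcal A=0$, then $(G,\mathbf p)$ is not universally rigid and flexes as a step ladder, i.e. there is a continuous edge-length-preserving motion of $(G,\mathbf p)$ in $\mathbb R^2$, starting at $\mathbf p$ (with $\mathbb R^1\subset\mathbb R^2$), through frameworks that are step ladders.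
   Context: The ladder graph $G$ has six vertices, labelled $A,B,C,a,b,c$, and nine edges: the edges of the two triangles $ABC$ and $abc$ (the "poles"), and the three "rungs" $Aa,Bb,Cc$. For a framework in $\mathbb R^1$ the same letters denote the real coordinates of the vertices. A framework $(G,\mathbf p)$ in $\mathbb R^d$ is a finite graph $G$ on $n$ vertices with $\mathbf p=(p_1,\dots,p_n)$, $p_i\in\mathbb R^d$. It is universally rigid if every $(G,\mathbf q)$, $\mathbf q$ a configuration in $\mathbb R^{d'}$ for some $d'\ge d$, with the same corresponding edge lengths has $\mathbf q$ congruent to $\mathbf p$. An equilibrium stress is an assignment of scalars $\omega_{ij}=\omega_{ji}$ (zero on non-edges) with $\sum_{j\ne i}\omega_{ij}(p_i-p_j)=0$ for every $i$; its stress matrix $\Omega$ is the symmetric $n\times n$ matrix with off-diagonal entries $-\omega_{ij}$ and row and column sums zero. The edge directions lie on a conic at infinity if there is a non-zero symmetric $d\times d$ matrix $Q$ with $(p_i-p_j)^tQ(p_i-p_j)=0$ for all edges $ij$. $(G,\mathbf p)$ is super stable in $\mathbb R^d$ if it has an equilibrium stress whose stress matrix is positive semi-definite of rank $n-d-1$ and its edge directions do not lie on a conic at infinity. Step ladder: a framework of $G$ in $\mathbb R^2$ with two-dimensional affine span, all edges of non-zero length, in which the points $A,B,C$ lie on a line, the points $a,b,c$ lie on a line, these two pole lines are parallel, and the three rung lines are parallel to each other. Discriminant: with $\mathcal A=(C-A)(b-a)-(c-a)(B-A)$, $\mathcal B=-(B+c)(C-A)(b-a)+(b+C)(c-a)(B-A)$,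 $\mathcal C=cB(C-A)(b-a)-Cb(c-a)(B-A)$, put $D(A,B,C,a,b,c)=\mathcal B^2-4\mathcal A\mathcal C$. *)

theory Defs
  imports "HOL-Analysis.Analysis"
begin

text \<open>A graph on a finite vertex type is given by its set of edges, each edge being a
  two-element set of vertices. A framework in \<open>\<real>\<^sup>d\<close> is a graph together with a
  configuration \<open>p :: 'v \<Rightarrow> real ^ 'd\<close>, where \<open>d = CARD('d)\<close>.\<close>

text \<open>Universal rigidity quantifies over the dimension \<open>d'\<close> of the competing framework, so
  those configurations cannot live in a type \<open>real ^ 'd\<close>. A point of
  \<open>d'\<close>-dimensional space is represented there by its coordinates \<open>x 0, \<dots>, x (d' - 1)\<close>; the values \<open>x k\<close> with \<open>k \<ge> d'\<close> are
  irrelevant.\<close>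

definition coord_dist :: "nat \<Rightarrow> (nat \<Rightarrow> real) \<Rightarrow> (nat \<Rightarrow> real) \<Rightarrow> real" where
  "coord_dist d x y = L2_set (\<lambda>k. x k - y k) {..<d}"

text \<open>Congruence of configurations in possibly different dimensions means that all pairwise
  distances agree.\<close>

definition universally_rigid :: "'v::finite set set \<Rightarrow> ('v \<Rightarrow> real ^ 'd) \<Rightarrow> bool" where
  "universally_rigid E p \<longleftrightarrow>
     (\<forall>d' \<ge> CARD('d). \<forall>q :: 'v \<Rightarrow> nat \<Rightarrow> real.
        (\<forall>i j. {i, j} \<in> E \<longrightarrow> coord_dist d' (q i) (q j) = dist (p i) (p j)) \<longrightarrow>
        (\<forall>i j. coord_dist d' (q i) (q j) = dist (p i) (p j)))"

definition equilibrium_stress ::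
    "'v::finite set set \<Rightarrow> ('v \<Rightarrow> real ^ 'd) \<Rightarrow> ('v \<Rightarrow> 'v \<Rightarrow> real) \<Rightarrow> bool" where
  "equilibrium_stress E p \<omega> \<longleftrightarrow>
     (\<forall>i j. \<omega> i j = \<omega> j i) \<and>
     (\<forall>i j. {i, j} \<notin> E \<longrightarrow> \<omega> i j = 0) \<and>
     (\<forall>i. (\<Sum>j\<in>UNIV - {i}. \<omega> i j *\<^sub>R (p i - p j)) = 0)"

definition stress_matrix :: "('v::finite \<Rightarrow> 'v \<Rightarrow> real) \<Rightarrow> real ^ 'v ^ 'v" where
  "stress_matrix \<omega> = (\<chi> i j. if i = j then (\<Sum>k\<in>UNIV - {i}. \<omega> i k) else - \<omega> i j)"

definition positive_semidefinite :: "real ^ 'n ^ 'n \<Rightarrow> bool" where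
  "positive_semidefinite M \<longleftrightarrow> transpose M = M \<and> (\<forall>x. 0 \<le> x \<bullet> (M *v x))"

definition on_conic_at_infinity :: "'v::finite set set \<Rightarrow> ('v \<Rightarrow> real ^ 'd) \<Rightarrow> bool" where
  "on_conic_at_infinity E p \<longleftrightarrow>
     (\<exists>Q :: real ^ 'd ^ 'd. Q \<noteq> 0 \<and> transpose Q = Q \<and>
        (\<forall>i j. {i, j} \<in> E \<longrightarrow> (p i - p j) \<bullet> (Q *v (p i - p j)) = 0))"

text \<open>The rank condition \<open>rank = n - d - 1\<close> is stated without subtraction, which truncates
  on \<open>nat\<close>.\<close>

definition super_stable :: "'v::finite set set \<Rightarrow> ('v \<Rightarrow> real ^ 'd) \<Rightarrow> bool" where
  "super_stable E p \<longleftrightarrow>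
     (\<exists>\<omega>. equilibrium_stress E p \<omega> \<and>
          positive_semidefinite (stress_matrix \<omega>) \<and>
          rank (stress_matrix \<omega>) + CARD('d) + 1 = CARD('v)) \<and>
     \<not> on_conic_at_infinity E p"

datatype vertex = VA | VB | VC | Va | Vb | Vc

lemma UNIV_vertex: "UNIV = {VA, VB, VC, Va, Vb, Vc}"
  using vertex.exhaust by blast

instance vertex :: finite
  by standard (simp add: UNIV_vertex)

definition ladder_edges :: "vertex set set" where
  "ladder_edges =
     {{VA, VB}, {VB, VC}, {VA, VC}, {Va, Vb}, {Vb, Vc}, {Va, Vc}, {VA, Va}, {VB, Vb}, {VC, Vc}}"

primrec ladder_config :: "'a \<Rightarrow> 'a \<Rightarrow> 'a \<Rightarrow> 'a \<Rightarrow> 'a \<Rightarrow> 'a \<Rightarrow> vertex \<Rightarrow> 'a" where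
  "ladder_config A B C a b c VA = A"
| "ladder_config A B C a b c VB = B"
| "ladder_config A B C a b c VC = C"
| "ladder_config A B C a b c Va = a"
| "ladder_config A B C a b c Vb = b"
| "ladder_config A B C a b c Vc = c"

definition line_point :: "real \<Rightarrow> real ^ 1" where
  "line_point x = vector [x]"

definition embed_plane :: "real ^ 1 \<Rightarrow> real ^ 2" where
  "embed_plane x = vector [x $ 1, 0]"

definition ladder_line ::
    "real \<Rightarrow> real \<Rightarrow> real \<Rightarrow> real \<Rightarrow> real \<Rightarrow> real \<Rightarrow> vertex \<Rightarrow> real ^ 1" where
  "ladder_line A B C a b c = line_point \<circ> ladder_config A B C a b c"

text \<open>Since the end points of every edge are distinct, the affine hulls below are the pole
  lines and the rung lines. Parallelism of affine sets allows them to coincide, but here this is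
  excluded by the two-dimensional affine span.\<close>

definition step_ladder :: "(vertex \<Rightarrow> real ^ 2) \<Rightarrow> bool" where
  "step_ladder q \<longleftrightarrow>
     aff_dim (range q) = 2 \<and>
     (\<forall>i j. {i, j} \<in> ladder_edges \<longrightarrow> q i \<noteq> q j) \<and>
     collinear {q VA, q VB, q VC} \<and>
     collinear {q Va, q Vb, q Vc} \<and>
     affine_parallel (affine hull {q VA, q VB, q VC}) (affine hull {q Va, q Vb, q Vc}) \<and>
     affine_parallel (affine hull {q VA, q Va}) (affine hull {q VB, q Vb}) \<and>
     affine_parallel (affine hull {q VB, q Vb}) (affine hull {q VC, q Vc}) \<and>
     affine_parallel (affine hull {q VA, q Va}) (affine hull {q VC, q Vc})"

text \<open>The starting framework lies on a line and so is not itself a step ladder; the frameworks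
  at all later times are.\<close>

definition flexes_as_step_ladder :: "(vertex \<Rightarrow> real ^ 1) \<Rightarrow> bool" where
  "flexes_as_step_ladder p \<longleftrightarrow>
     (\<exists>\<gamma> :: real \<Rightarrow> vertex \<Rightarrow> real ^ 2.
        (\<forall>i. continuous_on {0..1} (\<lambda>t. \<gamma> t i)) \<and>
        (\<forall>i. \<gamma> 0 i = embed_plane (p i)) \<and>
        (\<forall>t\<in>{0..1}. \<forall>i j. {i, j} \<in> ladder_edges \<longrightarrow>
           dist (\<gamma> t i) (\<gamma> t j) = dist (p i) (p j)) \<and>
        (\<forall>t\<in>{0<..1}. step_ladder (\<gamma> t)))"

definition quad_A :: "real \<Rightarrow> real \<Rightarrow> real \<Rightarrow> real \<Rightarrow> real \<Rightarrow> real \<Rightarrow> real" where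
  "quad_A A B C a b c = (C - A) * (b - a) - (c - a) * (B - A)"

definition quad_B :: "real \<Rightarrow> real \<Rightarrow> real \<Rightarrow> real \<Rightarrow> real \<Rightarrow> real \<Rightarrow> real" where
  "quad_B A B C a b c = - (B + c) * (C - A) * (b - a) + (b + C) * (c - a) * (B - A)"

definition quad_C :: "real \<Rightarrow> real \<Rightarrow> real \<Rightarrow> real \<Rightarrow> real \<Rightarrow> real \<Rightarrow> real" where
  "quad_C A B C a b c = c * B * (C - A) * (b - a) - C * b * (c - a) * (B - A)"

definition discriminant :: "real \<Rightarrow> real \<Rightarrow> real \<Rightarrow> real \<Rightarrow> real \<Rightarrow> real \<Rightarrow> real" where
  "discriminant A B C a b c =
     (quad_B A B C a b c)\<^sup>2 - 4 * quad_A A B C a b c * quad_C A B C a b c"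

end

theory Submission
  imports Defs
begin

text \<open>In every framework with the same edge lengths each pole stays straight. With unit directions
  \<open>u\<close>, \<open>v\<close> of the poles and the vector \<open>w\<close> between their origins, the rung joining the
  points with coordinates \<open>\<sigma>\<close>, \<open>\<tau>\<close> keeps its length iff
  \<open>|w|\<^sup>2 + 2 \<sigma> (w \<bullet> u) - 2 \<tau> (w \<bullet> v) + 2 \<sigma> \<tau> (1 - u \<bullet> v) = 0\<close>. Up to scale there is a single such
  bilinear form vanishing at the three rungs, i.e. a single Moebius map carrying \<open>A, B, C\<close> to
  \<open>a, b, c\<close>, and the discriminant is that of its fixed point equation. Without real fixed points
  a small multiple of the form comes from a positive semidefinite Gram matrix, which gives a
  non-congruent framework. With a double fixed point \<open>r\<close> the Gram matrix forces
  \<open>w = r (v - u)\<close>, and then \<open>u = v\<close> because \<open>r\<close> lies on at most two rungs. With two fixed points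
  duality provides a rung stress that is positive definite on infinitesimal motions keeping the
  poles straight; adding a large multiple of the self-stresses of the two collinear triangles
  makes it positive semidefinite of corank two. If the form has no quadratic term and the
  discriminant vanishes, the map is a translation and the rungs rotate in parallel.\<close>

section \<open>Stress matrices\<close>

lemma stress_matrix_vector_nth:
  "(stress_matrix \<omega> *v x) $ i = (\<Sum>j\<in>UNIV. \<omega> i j * (x $ i - x $ j))"
proof -
  have "(stress_matrix \<omega> *v x) $ i =
      (\<Sum>k\<in>UNIV - {i}. \<omega> i k) * x $ i + (\<Sum>j\<in>UNIV - {i}. - \<omega> i j * x $ j)"
    unfolding stress_matrix_def matrix_vector_mult_def
    by (simp add: sum.remove[of UNIV i])
  also have "\<dots> = (\<Sum>j\<in>UNIV - {i}. \<omega> i j * (x $ i - x $ j))"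
    by (simp add: sum_distrib_left sum.distrib[symmetric] algebra_simps
        sum_subtractf sum_negf)
  also have "\<dots> = (\<Sum>j\<in>UNIV. \<omega> i j * (x $ i - x $ j))"
    by (simp add: sum.remove[of UNIV i])
  finally show ?thesis .
qed

text \<open>Bilinear rather than quadratic, since the second-order argument against super stability
  pairs a correction \<open>h\<close> with the kernel vector \<open>P\<close>.\<close>

lemma inner_stress_matrix:
  assumes "\<And>i j. \<omega> i j = \<omega> j i"
  shows "2 * (y \<bullet> (stress_matrix \<omega> *v x)) =
    (\<Sum>i\<in>UNIV. \<Sum>j\<in>UNIV. \<omega> i j * ((y $ i - y $ j) * (x $ i - x $ j)))"
proof -
  have eq: "y \<bullet> (stress_matrix \<omega> *v x) = (\<Sum>i\<in>UNIV. \<Sum>j\<in>UNIV. \<omega> i j * (y $ i * (x $ i - x $ j)))"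
    by (simp add: inner_vec_def stress_matrix_vector_nth sum_distrib_left mult_ac)
  also have "\<dots> = (\<Sum>i\<in>UNIV. \<Sum>j\<in>UNIV. \<omega> i j * (y $ j * (x $ j - x $ i)))"
    by (subst sum.swap) (simp add: assms[symmetric] assms)
  finally have "2 * (y \<bullet> (stress_matrix \<omega> *v x)) =
      (\<Sum>i\<in>UNIV. \<Sum>j\<in>UNIV. \<omega> i j * (y $ i * (x $ i - x $ j))) +
      (\<Sum>i\<in>UNIV. \<Sum>j\<in>UNIV. \<omega> i j * (y $ j * (x $ j - x $ i)))"
    using eq by linarith
  then show ?thesis
    by (simp add: sum.distrib[symmetric] algebra_simps)
qed

lemma transpose_stress_matrix:
  assumes "\<And>i j. \<omega> i j = \<omega> j i"
  shows "transpose (stress_matrix \<omega>) = stress_matrix \<omega>"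
  using assms by (simp add: transpose_def stress_matrix_def vec_eq_iff)

lemma equilibrium_stress_line:
  fixes p :: "'v::finite \<Rightarrow> real ^ 1"
  shows "equilibrium_stress E p \<omega> \<longleftrightarrow> (\<forall>i j. \<omega> i j = \<omega> j i) \<and> (\<forall>i j. {i, j} \<notin> E \<longrightarrow> \<omega> i j = 0) \<and>
    stress_matrix \<omega> *v (\<chi> i. p i $ 1) = 0"
proof -
  have "(\<Sum>j\<in>UNIV - {i}. \<omega> i j *\<^sub>R (p i - p j)) = 0 \<longleftrightarrow>
      (\<Sum>j\<in>UNIV. \<omega> i j * (p i $ 1 - p j $ 1)) = 0" for i
    by (simp add: vec_eq_iff sum.remove[of UNIV i])
  then show ?thesis
    unfolding equilibrium_stress_def by (simp add: vec_eq_iff stress_matrix_vector_nth)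
qed

text \<open>Moving from \<open>x\<close> along \<open>M *v x\<close> changes the form to first order
  by twice the squared norm of \<open>M *v x\<close>, so a small negative step would make it
  negative.\<close>

lemma positive_semidefinite_kernel:
  assumes "positive_semidefinite M" and "x \<bullet> (M *v x) = 0"
  shows "M *v x = 0"
proof -
  define y where "y = M *v x"
  have sym: "u \<bullet> (M *v v) = (M *v u) \<bullet> v" for u v
    using assms(1) by (metis dot_lmul_matrix positive_semidefinite_def transpose_matrix_vector)
  have ge: "0 \<le> (x + t *\<^sub>R y) \<bullet> (M *v (x + t *\<^sub>R y))" for t
    using assms(1) unfolding positive_semidefinite_def by blast
  have expand: "(x + t *\<^sub>R y) \<bullet> (M *v (x + t *\<^sub>R y)) = 2 * t * (y \<bullet> y) + t\<^sup>2 * (y \<bullet> (M *v y))" for t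
    using assms(2) sym[of x y]
    by (simp add: matrix_vector_right_distrib inner_add_left inner_add_right
        matrix_vector_mult_scaleR power2_eq_square y_def[symmetric] algebra_simps)
  define m where "m = y \<bullet> (M *v y)"
  have m: "m \<ge> 0"
    using assms(1) unfolding positive_semidefinite_def m_def by blast
  have "y \<bullet> y \<le> 0"
  proof (rule ccontr)
    assume "\<not> y \<bullet> y \<le> 0"
    then have pos: "y \<bullet> y > 0" by (rule not_le_imp_less)
    \<comment> \<open>For positive \<open>m\<close> the minimiser is
      \<open>- (y \<bullet> y) / m\<close>; the extra 1 also covers \<open>m = 0\<close>.\<close>
    define t where "t = - (y \<bullet> y) / (m + 1)"
    have "t < 0" "t * m = - (y \<bullet> y) - t"
      using m pos unfolding t_def by (simp_all add: field_simps)
    then have "t * (y \<bullet> y - t) < 0"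
      using pos by (intro mult_neg_pos) linarith+
    also have "t * (y \<bullet> y - t) = 2 * t * (y \<bullet> y) + t * (t * m)"
      unfolding \<open>t * m = _\<close> by (simp add: algebra_simps)
    also have "\<dots> \<ge> 0"
      using ge[of t] expand[of t] by (simp add: m_def power2_eq_square mult.assoc)
    finally show False by simp
  qed
  then have "y = 0"
    by (simp add: inner_gt_zero_iff not_less[symmetric])
  then show ?thesis
    by (simp add: y_def)
qed

text \<open>The kernel is the orthogonal complement of the row space. This turns the rank condition
  of super stability into a count of independent kernel vectors.\<close>

lemma dim_kernel_plus_rank:
  fixes M :: "real ^ 'n ^ 'm"
  shows "dim {x. M *v x = 0} + rank M = CARD('n)"
proof -
  have "M *v x = 0 \<longleftrightarrow> (\<forall>r\<in>span (rows M). orthogonal r x)" for x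
  proof
    assume 0: "M *v x = 0"
    then have 0: "M $ i \<bullet> x = 0" for i
      by (simp add: matrix_mult_dot vec_eq_iff)
    have "orthogonal x r" if "r \<in> span (rows M)" for r
      using that
    proof (rule orthogonal_to_span)
      fix s assume "s \<in> rows M"
      then obtain i where "s = M $ i" by (auto simp: rows_def row_def)
      with 0 show "orthogonal x s"
        by (simp add: orthogonal_def inner_commute)
    qed
    then show "\<forall>r\<in>span (rows M). orthogonal r x"
      by (simp add: orthogonal_commute)
  next
    assume "\<forall>r\<in>span (rows M). orthogonal r x"
    then have "orthogonal (row i M) x" for i
      using span_base[of "row i M" "rows M"] by (auto simp: rows_def)
    then show "M *v x = 0"
      by (simp add: orthogonal_def matrix_mult_dot vec_eq_iff row_def)
  qed
  then show ?thesis
    using dim_subspace_orthogonal_to_vectors[of "span (rows M)" UNIV]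
    by (simp add: row_rank_def)
qed

section \<open>Ladder frameworks on a line\<close>

lemma sum_UNIV_vertex:
  "(\<Sum>i\<in>UNIV. f i) = f VA + f VB + f VC + f Va + f Vb + (f Vc :: 'a::comm_monoid_add)"
  unfolding UNIV_vertex by (simp add: add.assoc)

lemma ladder_edges_induct:
  assumes "{i, j} \<in> ladder_edges"
    and "\<And>i j. P i j \<Longrightarrow> P j i"
    and "P VA VB" "P VB VC" "P VA VC" "P Va Vb" "P Vb Vc" "P Va Vc"
    and "P VA Va" "P VB Vb" "P VC Vc"
  shows "P i j"
  using assms unfolding ladder_edges_def by (auto simp: doubleton_eq_iff)

lemma ladder_edges_mem:
  "{VA, VB} \<in> ladder_edges" "{VB, VC} \<in> ladder_edges" "{VA, VC} \<in> ladder_edges"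
  "{Va, Vb} \<in> ladder_edges" "{Vb, Vc} \<in> ladder_edges" "{Va, Vc} \<in> ladder_edges"
  "{VA, Va} \<in> ladder_edges" "{VB, Vb} \<in> ladder_edges" "{VC, Vc} \<in> ladder_edges"
  unfolding ladder_edges_def by simp_all

lemma line_point_nth [simp]: "line_point x $ 1 = x"
  unfolding line_point_def by simp

lemma dist_line_point [simp]: "dist (line_point x) (line_point y) = \<bar>x - y\<bar>"
  by (simp add: dist_real)

lemma ladder_line_apply [simp]:
  "ladder_line A B C a b c VA = line_point A" "ladder_line A B C a b c VB = line_point B"
  "ladder_line A B C a b c VC = line_point C" "ladder_line A B C a b c Va = line_point a"
  "ladder_line A B C a b c Vb = line_point b" "ladder_line A B C a b c Vc = line_point c"
  unfolding ladder_line_def by simp_all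

lemma coord_dist_power2: "(coord_dist d x y)\<^sup>2 = (\<Sum>k<d. (x k - y k)\<^sup>2)"
  unfolding coord_dist_def L2_set_def by (simp add: sum_nonneg)

text \<open>Numbering the index type by \<open>h\<close> turns a competitor in
  \<open>real ^ 'm\<close> into coordinate functions, so counterexamples can be built in a vector
  type.\<close>

lemma universally_rigidD:
  fixes p :: "'v::finite \<Rightarrow> real ^ 'd" and q :: "'v \<Rightarrow> real ^ 'm"
  assumes "universally_rigid E p" and "CARD('d) \<le> CARD('m)"
    and "\<And>i j. {i, j} \<in> E \<Longrightarrow> dist (q i) (q j) = dist (p i) (p j)"
  shows "dist (q i) (q j) = dist (p i) (p j)"
proof -
  obtain h :: "nat \<Rightarrow> 'm" where h: "bij_betw h {0..<CARD('m)} UNIV"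
    using ex_bij_betw_nat_finite[OF finite_class.finite_UNIV] by blast
  define q' where "q' i k = q i $ h k" for i k
  have "coord_dist CARD('m) (q' i) (q' j) = dist (q i) (q j)" for i j
    using sum.reindex_bij_betw[OF h, of "\<lambda>k. (q i $ k - q j $ k)\<^sup>2"]
    by (simp add: coord_dist_def L2_set_def dist_vec_def dist_real_def q'_def atLeast0LessThan)
  then show ?thesis
    using assms(1)[unfolded universally_rigid_def, rule_format, of "CARD('m)" q'] assms(2,3) by auto
qed

lemma mem_span_two_iff:
  fixes x y z :: "'a::real_vector"
  shows "z \<in> span {x, y} \<longleftrightarrow> (\<exists>s t. z = s *\<^sub>R x + t *\<^sub>R y)"
  by (auto simp: span_breakdown_eq algebra_simps)

text \<open>The form is \<open>(C - A) (b - a) (\<sigma> - B) (\<tau> - c) - (c - a) (B - A) (\<sigma> - C) (\<tau> - b)\<close>,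
  divided by its leading coefficient \<open>quad_A\<close>; on the diagonal it is the quadratic of the paper.\<close>

lemma rung_relation:
  assumes "quad_A A B C a b c \<noteq> 0"
  obtains s x y where
    "s + 2 * A * x - 2 * a * y + A * a = 0"
    "s + 2 * B * x - 2 * b * y + B * b = 0"
    "s + 2 * C * x - 2 * c * y + C * c = 0"
    "discriminant A B C a b c = 4 * (quad_A A B C a b c)\<^sup>2 * ((x - y)\<^sup>2 - s)"
proof -
  define Q where "Q = quad_A A B C a b c"
  \<comment> \<open>\<open>X\<close> and \<open>Y\<close> are the coefficients of \<sigma> and
    \<tau> before division by \<open>Q\<close>, so \<open>quad_B\<close> is \<open>X + Y\<close>.
    The monic diagonal quadratic is
    \<open>\<sigma>\<^sup>2 + 2 * (x - y) * \<sigma> + s\<close>.\<close>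
  define X where "X = b * (c - a) * (B - A) - c * (C - A) * (b - a)"
  define Y where "Y = C * (c - a) * (B - A) - B * (C - A) * (b - a)"
  define s where "s = quad_C A B C a b c / Q"
  define x where "x = X / (2 * Q)"
  define y where "y = - Y / (2 * Q)"
  note defs = quad_A_def quad_B_def quad_C_def X_def Y_def Q_def
  have Q: "Q \<noteq> 0" using assms by (simp add: Q_def)
  have form: "s + 2 * \<sigma> * x - 2 * \<tau> * y + \<sigma> * \<tau> =
      (quad_C A B C a b c + X * \<sigma> + Y * \<tau> + Q * \<sigma> * \<tau>) / Q" for \<sigma> \<tau>
    using Q unfolding s_def x_def y_def by (simp add: field_simps)
  show thesis
  proof (rule that[of s x y])
    show "s + 2 * A * x - 2 * a * y + A * a = 0"
      unfolding form by (simp add: defs) algebra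
    show "s + 2 * B * x - 2 * b * y + B * b = 0"
      unfolding form by (simp add: defs) algebra
    show "s + 2 * C * x - 2 * c * y + C * c = 0"
      unfolding form by (simp add: defs) algebra
    have "2 * Q * (x - y) = X + Y"
      using Q by (simp add: x_def y_def field_simps)
    then have "quad_B A B C a b c = 2 * Q * (x - y)"
      by (simp add: quad_B_def X_def Y_def algebra_simps)
    moreover have "quad_C A B C a b c = Q * s"
      using Q by (simp add: s_def)
    ultimately show "discriminant A B C a b c = 4 * (quad_A A B C a b c)\<^sup>2 * ((x - y)\<^sup>2 - s)"
      unfolding discriminant_def Q_def[symmetric] by algebra
  qed
qed

text \<open>By polarisation the three lengths force the inner product of the unit vector
  \<open>u\<close> with \<open>v = S - P\<close> to be \<open>C - A\<close>, while \<open>v\<close>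
  has norm \<open>\<bar>C - A\<bar>\<close>: the equality case of Cauchy-Schwarz. Signed coordinates
  avoid a case split on the order of the points.\<close>

lemma coord_dist_collinear_triangle:
  assumes "A \<noteq> B"
    and "coord_dist d P R = \<bar>A - B\<bar>" "coord_dist d R S = \<bar>B - C\<bar>" "coord_dist d P S = \<bar>A - C\<bar>"
  obtains u where "(\<Sum>k<d. (u k)\<^sup>2) = 1"
    "\<And>k. k < d \<Longrightarrow> R k = P k + (B - A) * u k" "\<And>k. k < d \<Longrightarrow> S k = P k + (C - A) * u k"
proof -
  define u where "u k = (R k - P k) / (B - A)" for k
  define v where "v k = S k - P k" for k
  have R: "R k = P k + (B - A) * u k" for k
    using assms(1) by (simp add: u_def)
  have "(\<Sum>k<d. (P k - R k)\<^sup>2) = (A - B)\<^sup>2"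
    using assms(2) by (metis coord_dist_power2 power2_abs)
  then have "(B - A)\<^sup>2 * (\<Sum>k<d. (u k)\<^sup>2) = (B - A)\<^sup>2"
    by (simp add: R power_mult_distrib sum_distrib_left power2_commute)
  then have u: "(\<Sum>k<d. (u k)\<^sup>2) = 1"
    using assms(1) by simp
  have v: "(\<Sum>k<d. (v k)\<^sup>2) = (C - A)\<^sup>2"
    using assms(4) unfolding v_def by (metis (no_types, lifting) coord_dist_power2 power2_abs power2_commute sum.cong)
  have "(\<Sum>k<d. (R k - S k)\<^sup>2) = (B - C)\<^sup>2"
    using assms(3) by (metis coord_dist_power2 power2_abs)
  moreover have "(R k - S k)\<^sup>2 = (B - A)\<^sup>2 * (u k)\<^sup>2 + (v k)\<^sup>2 - 2 * (B - A) * (u k * v k)" for k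
    by (simp add: R v_def power2_eq_square algebra_simps)
  ultimately have uv: "(B - A)\<^sup>2 + (C - A)\<^sup>2 - 2 * (B - A) * (\<Sum>k<d. u k * v k) = (B - C)\<^sup>2"
    using u v by (simp add: sum.distrib sum_subtractf sum_distrib_left[symmetric])
  have "2 * (B - A) * ((\<Sum>k<d. u k * v k) - (C - A)) = 0"
    using uv by (simp add: power2_eq_square algebra_simps)
  then have uv: "(\<Sum>k<d. u k * v k) = C - A"
    using assms(1) by simp
  have "(v k - (C - A) * u k)\<^sup>2 = (v k)\<^sup>2 + (C - A)\<^sup>2 * (u k)\<^sup>2 - 2 * (C - A) * (u k * v k)" for k
    by (simp add: power2_eq_square algebra_simps)
  then have "(\<Sum>k<d. (v k - (C - A) * u k)\<^sup>2) = 0"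
    using u v uv by (simp add: sum.distrib sum_subtractf sum_distrib_left[symmetric] power2_eq_square)
  then have "v k = (C - A) * u k" if "k < d" for k
    using that by (simp add: sum_nonneg_eq_0_iff)
  then show thesis
    using that[of u] R u by (force simp: v_def)
qed

section \<open>Negative discriminant: a competing framework in three-space\<close>

lemma dist_vec3:
  "dist (vector [x1, x2, x3] :: real ^ 3) (vector [y1, y2, y3]) =
    sqrt ((x1 - y1)\<^sup>2 + (x2 - y2)\<^sup>2 + (x3 - y3)\<^sup>2)"
  by (simp add: dist_vec_def L2_set_def sum_3 dist_real_def)

lemma dist_vec2:
  "dist (vector [x1, x2] :: real ^ 2) (vector [y1, y2]) = sqrt ((x1 - y1)\<^sup>2 + (x2 - y2)\<^sup>2)"
  by (simp add: dist_vec_def L2_set_def sum_2 dist_real_def)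

text \<open>Since \<open>s - (x - y)\<^sup>2\<close> is positive, for small \<open>t\<close> there
  are unit vectors \<open>u\<close>, \<open>v\<close> and a vector \<open>w\<close> in three-space
  with inner products \<open>t * s\<close> (of \<open>w\<close> with itself), \<open>t * x\<close>
  (with \<open>u\<close>), \<open>t * y\<close> (with \<open>v\<close>) and \<open>1 - t / 2\<close>
  (of \<open>u\<close> with \<open>v\<close>). They add \<open>t\<close> times the form to the
  squared rung lengths.\<close>

lemma not_universally_rigid_if_discriminant_neg:
  assumes "A \<noteq> B" "a \<noteq> b" "discriminant A B C a b c < 0"
  shows "\<not> universally_rigid ladder_edges (ladder_line A B C a b c)"
proof
  assume rigid: "universally_rigid ladder_edges (ladder_line A B C a b c)"
  have "quad_A A B C a b c \<noteq> 0"
    using assms(3) by (auto simp: discriminant_def)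
  then obtain s x y where rA: "s + 2 * A * x - 2 * a * y + A * a = 0"
    and rB: "s + 2 * B * x - 2 * b * y + B * b = 0"
    and rC: "s + 2 * C * x - 2 * c * y + C * c = 0"
    and "discriminant A B C a b c = 4 * (quad_A A B C a b c)\<^sup>2 * ((x - y)\<^sup>2 - s)"
    by (rule rung_relation)
  with assms(3) have "(x - y)\<^sup>2 - s < 0"
    by (metis mult_nonneg_nonneg not_le zero_le_numeral zero_le_power2)
  \<comment> \<open>The second bound is what \<open>small\<close> needs, which in turn makes the
    height \<open>w3\<close> real; the cap 1 keeps \<open>1 - t / 4\<close> positive and
    \<open>si\<close> non-zero.\<close>
  define t where "t = min 1 ((s - (x - y)\<^sup>2) / (\<bar>s / 4 + x * y\<bar> + 1))"
  have t: "0 < t" "t \<le> 1"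
    using \<open>(x - y)\<^sup>2 - s < 0\<close> by (auto simp: t_def)
  have "t * (s / 4 + x * y) \<le> t * (\<bar>s / 4 + x * y\<bar> + 1)"
    using t by (intro mult_left_mono) auto
  also have "\<dots> \<le> s - (x - y)\<^sup>2"
  proof -
    have "t \<le> (s - (x - y)\<^sup>2) / (\<bar>s / 4 + x * y\<bar> + 1)"
      unfolding t_def by (rule min.cobounded2)
    then show ?thesis
      by (subst (asm) pos_le_divide_eq) auto
  qed
  finally have small: "(y - x + t * x / 2)\<^sup>2 \<le> (s - t * x\<^sup>2) * (1 - t / 4)"
    by (simp add: power2_eq_square field_simps)
  \<comment> \<open>Cosine and sine of the angle between the poles.\<close>
  define co where "co = 1 - t / 2"
  define si where "si = sqrt (t * (1 - t / 4))"
  have si: "si\<^sup>2 = t * (1 - t / 4)" "si \<noteq> 0"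
    using t by (auto simp: si_def)
  \<comment> \<open>\<open>w2\<close> is forced by the inner product \<open>t * y\<close> with the
    second pole direction; \<open>w3\<close> then supplies what is missing to the squared norm
    \<open>t * s\<close>.\<close>
  define w2 where "w2 = t * (y - x * co) / si"
  have w2: "w2 * si = t * (y - x * co)"
    using si by (simp add: w2_def)
  have "w2\<^sup>2 * (1 - t / 4) = t * (y - x * co)\<^sup>2"
  proof -
    have "t * (w2\<^sup>2 * (1 - t / 4)) = t * (t * (y - x * co)\<^sup>2)"
      using w2 si(1) by (metis (no_types, opaque_lifting) mult.assoc mult.left_commute power2_eq_square power_mult_distrib)
    then show ?thesis using t by simp
  qed
  also have "(y - x * co)\<^sup>2 = (y - x + t * x / 2)\<^sup>2"
    by (simp add: co_def algebra_simps)
  finally have "w2\<^sup>2 * (1 - t / 4) \<le> (t * s - (t * x)\<^sup>2) * (1 - t / 4)"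
    using mult_left_mono[OF small, of t] t by (simp add: power2_eq_square algebra_simps)
  then have w3_nonneg: "0 \<le> t * s - (t * x)\<^sup>2 - w2\<^sup>2"
    using t by simp
  define w3 where "w3 = sqrt (t * s - (t * x)\<^sup>2 - w2\<^sup>2)"
  have w3: "w3\<^sup>2 = t * s - (t * x)\<^sup>2 - w2\<^sup>2"
    using w3_nonneg by (simp add: w3_def)
  define pole :: "real \<Rightarrow> real ^ 3" where "pole \<sigma> = vector [\<sigma> + t * x, w2, w3]" for \<sigma>
  define pole' :: "real \<Rightarrow> real ^ 3" where "pole' \<tau> = vector [\<tau> * co, \<tau> * si, 0]" for \<tau>
  have dist_pole: "dist (pole \<sigma>) (pole \<sigma>') = \<bar>\<sigma> - \<sigma>'\<bar>" for \<sigma> \<sigma>'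
    by (simp add: pole_def dist_vec3)
  have cs: "co\<^sup>2 + si\<^sup>2 = 1"
    unfolding si(1) by (simp add: co_def power2_eq_square algebra_simps)
  have "(\<tau> * co - \<tau>' * co)\<^sup>2 + (\<tau> * si - \<tau>' * si)\<^sup>2 = (\<tau> - \<tau>')\<^sup>2" for \<tau> \<tau>'
    using cs by algebra
  then have dist_pole': "dist (pole' \<tau>) (pole' \<tau>') = \<bar>\<tau> - \<tau>'\<bar>" for \<tau> \<tau>'
    by (simp add: pole'_def dist_vec3)
  have "(\<sigma> + t * x - \<tau> * co)\<^sup>2 + (w2 - \<tau> * si)\<^sup>2 + w3\<^sup>2 =
      (\<sigma> - \<tau>)\<^sup>2 + t * (s + 2 * \<sigma> * x - 2 * \<tau> * y + \<sigma> * \<tau>)" for \<sigma> \<tau>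
  proof -
    have "(\<sigma> + t * x - \<tau> * co)\<^sup>2 + (w2 - \<tau> * si)\<^sup>2 + w3\<^sup>2 =
       \<sigma>\<^sup>2 + 2 * \<sigma> * t * x - 2 * \<sigma> * \<tau> * co - 2 * \<tau> * (t * x * co) - 2 * \<tau> * (w2 * si)
        + \<tau>\<^sup>2 * (co\<^sup>2 + si\<^sup>2) + t * s"
      unfolding w3 by (simp add: power2_eq_square algebra_simps)
    then show ?thesis
      unfolding w2 cs by (simp add: co_def power2_eq_square algebra_simps)
  qed
  then have dist_rung: "dist (pole \<sigma>) (pole' \<tau>) =
      sqrt ((\<sigma> - \<tau>)\<^sup>2 + t * (s + 2 * \<sigma> * x - 2 * \<tau> * y + \<sigma> * \<tau>))" for \<sigma> \<tau>
    by (simp add: pole_def pole'_def dist_vec3)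
  then have dist_rung': "dist (pole' \<tau>) (pole \<sigma>) =
      sqrt ((\<sigma> - \<tau>)\<^sup>2 + t * (s + 2 * \<sigma> * x - 2 * \<tau> * y + \<sigma> * \<tau>))" for \<sigma> \<tau>
    by (simp add: dist_commute[of "pole' \<tau>" "pole \<sigma>"])
  define q where "q = ladder_config (pole A) (pole B) (pole C) (pole' a) (pole' b) (pole' c)"
  have q: "dist (q i) (q j) = dist (ladder_line A B C a b c i) (ladder_line A B C a b c j)"
    if "{i, j} \<in> ladder_edges" for i j
    using that
    by (rule ladder_edges_induct)
      (simp_all add: q_def dist_commute dist_pole dist_pole' dist_rung dist_rung' rA rB rC)
  have "dist (q i) (q j) = dist (ladder_line A B C a b c i) (ladder_line A B C a b c j)" for i j
    using universally_rigidD[OF rigid, of q] q by simp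
  \<comment> \<open>If both diagonals kept their lengths, the form would vanish on all four pairs
    from \<open>A\<close>, \<open>B\<close> and \<open>a\<close>, \<open>b\<close>, but its mixed
    difference there is \<open>(A - B) * (a - b)\<close>.\<close>
  from this[of VA Vb] this[of VB Va]
  have "sqrt ((A - b)\<^sup>2 + t * (s + 2 * A * x - 2 * b * y + A * b)) = sqrt ((A - b)\<^sup>2)"
    "sqrt ((B - a)\<^sup>2 + t * (s + 2 * B * x - 2 * a * y + B * a)) = sqrt ((B - a)\<^sup>2)"
    by (simp_all add: q_def dist_rung)
  then have "s + 2 * A * x - 2 * b * y + A * b = 0" "s + 2 * B * x - 2 * a * y + B * a = 0"
    using t by (simp_all del: real_sqrt_abs)
  with rA rB have "(A - B) * (a - b) = 0"
    by algebra
  with assms(1,2) show False by simp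
qed

section \<open>Double fixed point: universal rigidity\<close>

text \<open>The diagonal quadratic is now the square of \<open>\<sigma> - r\<close> with
  \<open>r = y - x\<close>. Each equation splits the form at a rung into its diagonal value and a
  multiple of the signed rung length, the shape of a second-order edge condition.\<close>

lemma rung_relation_double_root:
  assumes "discriminant A B C a b c = 0" "quad_A A B C a b c \<noteq> 0"
  obtains r y where
    "(A - r)\<^sup>2 + (A - a) * (2 * y - A) = 0"
    "(B - r)\<^sup>2 + (B - b) * (2 * y - B) = 0"
    "(C - r)\<^sup>2 + (C - c) * (2 * y - C) = 0"
proof -
  obtain s x y where r: "s + 2 * A * x - 2 * a * y + A * a = 0"
    "s + 2 * B * x - 2 * b * y + B * b = 0"
    "s + 2 * C * x - 2 * c * y + C * c = 0"
    and "discriminant A B C a b c = 4 * (quad_A A B C a b c)\<^sup>2 * ((x - y)\<^sup>2 - s)"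
    using rung_relation[OF assms(2)] by metis
  then have s: "s = (y - x)\<^sup>2"
    using assms by (simp add: power2_commute)
  show thesis
    by (rule that[of "y - x" y]) (use r s in algebra)+
qed

text \<open>Up to sign \<open>quad_A\<close> is twice the signed area of the triangle
  \<open>(A, a)\<close>, \<open>(B, b)\<close>, \<open>(C, c)\<close>, so only the zero affine
  function vanishes at all three points.\<close>

lemma affine_relation_trivial:
  fixes s x y :: real
  assumes "s + A * x + a * y = 0" "s + B * x + b * y = 0" "s + C * x + c * y = 0"
    and "quad_A A B C a b c \<noteq> 0"
  shows "s = 0 \<and> x = 0 \<and> y = 0"
proof -
  have "x * quad_A A B C a b c = 0" "y * quad_A A B C a b c = 0"
    using assms(1-3) unfolding quad_A_def by algebra+
  then show ?thesis
    using assms by simp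
qed

lemma universally_rigid_if_double_root:
  assumes "A \<noteq> B" "A \<noteq> C" "B \<noteq> C" "a \<noteq> b" "a \<noteq> c" "b \<noteq> c"
    and "A \<noteq> a" "B \<noteq> b" "C \<noteq> c"
    and "discriminant A B C a b c = 0" "quad_A A B C a b c \<noteq> 0"
  shows "universally_rigid ladder_edges (ladder_line A B C a b c)"
  unfolding universally_rigid_def
proof (intro allI impI)
  fix d q i j
  assume d: "CARD(1) \<le> d" and edges: "\<forall>i j. {i, j} \<in> ladder_edges \<longrightarrow>
    coord_dist d (q i) (q j) = dist (ladder_line A B C a b c i) (ladder_line A B C a b c j)"
  note e = edges[rule_format, OF ladder_edges_mem(1)] edges[rule_format, OF ladder_edges_mem(2)]
    edges[rule_format, OF ladder_edges_mem(3)] edges[rule_format, OF ladder_edges_mem(4)]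
    edges[rule_format, OF ladder_edges_mem(5)] edges[rule_format, OF ladder_edges_mem(6)]
    edges[rule_format, OF ladder_edges_mem(7)] edges[rule_format, OF ladder_edges_mem(8)]
    edges[rule_format, OF ladder_edges_mem(9)]
  note e = e[simplified]
  obtain u where u: "(\<Sum>k<d. (u k)\<^sup>2) = 1"
    and qB: "\<And>k. k < d \<Longrightarrow> q VB k = q VA k + (B - A) * u k"
    and qC: "\<And>k. k < d \<Longrightarrow> q VC k = q VA k + (C - A) * u k"
    using coord_dist_collinear_triangle[OF assms(1) e(1,2,3)] by blast
  obtain v where v: "(\<Sum>k<d. (v k)\<^sup>2) = 1"
    and qb: "\<And>k. k < d \<Longrightarrow> q Vb k = q Va k + (b - a) * v k"
    and qc: "\<And>k. k < d \<Longrightarrow> q Vc k = q Va k + (c - a) * v k"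
    using coord_dist_collinear_triangle[OF assms(4) e(4,5,6)] by blast
  \<comment> \<open>The offset between the points of parameter 0 on the two pole lines.\<close>
  define w where "w k = q VA k - q Va k - A * u k + a * v k" for k
  define z where "z = 1 - (\<Sum>k<d. u k * v k)"
  define s where "s = (\<Sum>k<d. (w k)\<^sup>2)"
  define x where "x = (\<Sum>k<d. w k * u k)"
  define y where "y = (\<Sum>k<d. w k * v k)"
  \<comment> \<open>\<open>\<kappa> = 1\<close> gives squared distances between pole points,
    \<open>\<kappa> = 0\<close> compares the two directions alone.\<close>
  have gram: "(\<Sum>k<d. (\<kappa> * w k + \<sigma> * u k - \<tau> * v k)\<^sup>2) =
      (\<sigma> - \<tau>)\<^sup>2 + \<kappa>\<^sup>2 * s + 2 * \<kappa> * \<sigma> * x - 2 * \<kappa> * \<tau> * y + 2 * \<sigma> * \<tau> * z" for \<kappa> \<sigma> \<tau>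
  proof -
    have "(\<kappa> * w k + \<sigma> * u k - \<tau> * v k)\<^sup>2 = \<kappa>\<^sup>2 * (w k)\<^sup>2 + \<sigma>\<^sup>2 * (u k)\<^sup>2 + \<tau>\<^sup>2 * (v k)\<^sup>2
        + 2 * \<kappa> * \<sigma> * (w k * u k) - 2 * \<kappa> * \<tau> * (w k * v k) - 2 * \<sigma> * \<tau> * (u k * v k)" for k
      by (simp add: power2_eq_square algebra_simps)
    then have "(\<Sum>k<d. (\<kappa> * w k + \<sigma> * u k - \<tau> * v k)\<^sup>2) = \<kappa>\<^sup>2 * s + \<sigma>\<^sup>2 + \<tau>\<^sup>2
        + 2 * \<kappa> * \<sigma> * x - 2 * \<kappa> * \<tau> * y - 2 * \<sigma> * \<tau> * (1 - z)"
      using u v by (simp add: sum.distrib sum_subtractf sum_distrib_left[symmetric] s_def x_def y_def z_def)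
    then show ?thesis
      by (simp add: power2_eq_square algebra_simps)
  qed
  have rung: "s + 2 * \<sigma> * x - 2 * \<tau> * y + 2 * \<sigma> * \<tau> * z = 0"
    if "coord_dist d f g = \<bar>\<sigma> - \<tau>\<bar>" "\<And>k. k < d \<Longrightarrow> f k - g k = w k + \<sigma> * u k - \<tau> * v k" for f g \<sigma> \<tau>
  proof -
    have "(\<Sum>k<d. (w k + \<sigma> * u k - \<tau> * v k)\<^sup>2) = (\<sigma> - \<tau>)\<^sup>2"
      using that coord_dist_power2[of d f g] by simp
    then show ?thesis using gram[of 1 \<sigma> \<tau>] by simp
  qed
  have rA: "s + 2 * A * x - 2 * a * y + 2 * A * a * z = 0"
    by (rule rung[OF e(7)]) (simp add: w_def)
  have rB: "s + 2 * B * x - 2 * b * y + 2 * B * b * z = 0"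
    by (rule rung[OF e(8)]) (simp add: w_def qB qb algebra_simps)
  have rC: "s + 2 * C * x - 2 * c * y + 2 * C * c * z = 0"
    by (rule rung[OF e(9)]) (simp add: w_def qC qc algebra_simps)
  obtain r y0 where r: "(A - r)\<^sup>2 + (A - a) * (2 * y0 - A) = 0"
    "(B - r)\<^sup>2 + (B - b) * (2 * y0 - B) = 0"
    "(C - r)\<^sup>2 + (C - c) * (2 * y0 - C) = 0"
    using rung_relation_double_root[OF assms(10,11)] by metis
  \<comment> \<open>Subtracting \<open>2 * z\<close> times the monic form cancels the bilinear term
    and leaves an affine function vanishing at the three rungs.\<close>
  have "s - 2 * z * r\<^sup>2 = 0 \<and> 2 * x - 2 * z * (2 * y0 - 2 * r) = 0 \<and> - 2 * y + 4 * z * y0 = 0"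
  proof (rule affine_relation_trivial[OF _ _ _ assms(11)])
    show "s - 2 * z * r\<^sup>2 + A * (2 * x - 2 * z * (2 * y0 - 2 * r)) + a * (- 2 * y + 4 * z * y0) = 0"
      using rA r(1) by algebra
    show "s - 2 * z * r\<^sup>2 + B * (2 * x - 2 * z * (2 * y0 - 2 * r)) + b * (- 2 * y + 4 * z * y0) = 0"
      using rB r(2) by algebra
    show "s - 2 * z * r\<^sup>2 + C * (2 * x - 2 * z * (2 * y0 - 2 * r)) + c * (- 2 * y + 4 * z * y0) = 0"
      using rC r(3) by algebra
  qed
  then have s: "s = 2 * z * r\<^sup>2" and xy: "x - y = - 2 * z * r"
    by (simp_all add: algebra_simps)
  \<comment> \<open>At the double root the Gram matrix degenerates in the direction \<open>(1, r, - r)\<close>.\<close>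
  have "(\<Sum>k<d. (w k + r * u k - r * v k)\<^sup>2) = 0"
    using gram[of 1 r r] s xy by (simp add: power2_eq_square) algebra
  then have w: "w k = r * (v k - u k)" if "k < d" for k
    using that by (simp add: sum_nonneg_eq_0_iff algebra_simps)
  have "x = (\<Sum>k<d. r * (u k * v k) - r * (u k)\<^sup>2)" "y = (\<Sum>k<d. r * (v k)\<^sup>2 - r * (u k * v k))"
    unfolding x_def y_def by (auto intro!: sum.cong simp: w power2_eq_square algebra_simps)
  then have x: "x = - r * z" and y: "y = r * z"
    using u v by (simp_all add: z_def sum_subtractf sum_distrib_left[symmetric] algebra_simps)
  \<comment> \<open>The form has become \<open>2 * z * (\<sigma> - r) * (\<tau> - r)\<close>. At
    most one of \<open>A\<close>, \<open>B\<close>, \<open>C\<close> and one of \<open>a\<close>,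
    \<open>b\<close>, \<open>c\<close> equals \<open>r\<close>, so some rung gives
    \<open>z = 0\<close>.\<close>
  have "z * ((A - r) * (a - r)) = 0" "z * ((B - r) * (b - r)) = 0" "z * ((C - r) * (c - r)) = 0"
    using rA rB rC s x y by algebra+
  then have z: "z = 0"
    using assms(1-6) by auto
  then have "s = 0"
    using s by simp
  have w0: "w k = 0" if "k < d" for k
    using \<open>s = 0\<close> that unfolding s_def by (simp add: sum_nonneg_eq_0_iff)
  have uv: "u k = v k" if "k < d" for k
    using gram[of 0 1 1] z that by (simp add: sum_nonneg_eq_0_iff)
  define P where "P = ladder_config A B C a b c"
  have "q i k - q j k = (P i - P j) * u k" if "k < d" for i j k
  proof -
    have "q m k = q VA k + (P m - A) * u k" for m
      using that w0[OF that] qB[OF that] qC[OF that] qb[OF that] qc[OF that] uv[OF that]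
      by (cases m) (simp_all add: P_def w_def algebra_simps)
    from this[of i] this[of j] show ?thesis
      by (simp add: algebra_simps)
  qed
  then have "(coord_dist d (q i) (q j))\<^sup>2 = (\<Sum>k<d. (P i - P j)\<^sup>2 * (u k)\<^sup>2)"
    unfolding coord_dist_power2 by (simp add: power_mult_distrib)
  also have "\<dots> = (P i - P j)\<^sup>2"
    using u by (simp add: sum_distrib_left[symmetric])
  finally show "coord_dist d (q i) (q j) = dist (ladder_line A B C a b c i) (ladder_line A B C a b c j)"
    unfolding ladder_line_def P_def
    by (simp add: coord_dist_def L2_set_nonneg power2_eq_iff_nonneg[symmetric, of _ "\<bar>_\<bar>"])
qed

section \<open>Step ladders and the parallel motion of the rungs\<close>

lemma affine_parallel_translate:
  "affine_parallel (affine hull S) (affine hull ((\<lambda>x. a + x) ` S))"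
  unfolding affine_parallel_def affine_hull_translation by blast

lemma collinear_horizontal:
  "collinear {vector [x1, h] :: real ^ 2, vector [x2, h], vector [x3, h]}"
  unfolding collinear_def
proof (rule exI[of _ "vector [1, 0]"], intro ballI)
  fix x y :: "real ^ 2"
  assume "x \<in> {vector [x1, h], vector [x2, h], vector [x3, h]}"
    "y \<in> {vector [x1, h], vector [x2, h], vector [x3, h]}"
  then have "x - y = (x $ 1 - y $ 1) *\<^sub>R vector [1, 0]"
    by (auto simp: vec_eq_iff forall_2)
  then show "\<exists>c. x - y = c *\<^sub>R vector [1, 0]" ..
qed

lemma step_ladder_translated:
  assumes "A \<noteq> B" "A \<noteq> C" "B \<noteq> C" "h \<noteq> 0"
  shows "step_ladder (ladder_config (vector [A, 0]) (vector [B, 0]) (vector [C, 0])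
    (vector [A + g, h]) (vector [B + g, h]) (vector [C + g, h]))" (is "step_ladder ?q")
proof -
  have shift: "vector [x, y] + vector [x', y'] = (vector [x + x', y + y'] :: real ^ 2)" for x y x' y' :: real
    by (simp add: vec_eq_iff forall_2)
  have neq: "vector [x, y] = (vector [x', y'] :: real ^ 2) \<longleftrightarrow> x = x' \<and> y = y'" for x y x' y' :: real
    by (auto simp: vec_eq_iff forall_2)
  have poles: "(\<lambda>v. vector [g, h] + v) ` {?q VA, ?q VB, ?q VC} = {?q Va, ?q Vb, ?q Vc}"
    by (simp add: shift add.commute)
  have rungs: "affine_parallel (affine hull {vector [X, 0] :: real ^ 2, vector [X + g, h]})
      (affine hull {vector [Y, 0], vector [Y + g, h]})" for X Y
    using affine_parallel_translate[of "{vector [X, 0] :: real ^ 2, vector [X + g, h]}" "vector [Y - X, 0]"]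
    by (simp add: shift)
  have "\<not> collinear {vector [A, 0], vector [B, 0], vector [A + g, h] :: real ^ 2}"
  proof
    assume "collinear {vector [A, 0], vector [B, 0], vector [A + g, h] :: real ^ 2}"
    then obtain u :: "real ^ 2" where
      u: "\<And>x y. x \<in> {vector [A, 0], vector [B, 0], vector [A + g, h]} \<Longrightarrow>
        y \<in> {vector [A, 0], vector [B, 0], vector [A + g, h]} \<Longrightarrow> \<exists>c. x - y = c *\<^sub>R u"
      unfolding collinear_def by blast
    obtain k l where "vector [A, 0] - vector [B, 0] = k *\<^sub>R u"
      "vector [A + g, h] - vector [A, 0] = l *\<^sub>R u"
      using u[of "vector [A, 0]" "vector [B, 0]"] u[of "vector [A + g, h]" "vector [A, 0]"] by auto
    then show False
      using assms by (auto simp: vec_eq_iff forall_2)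
  qed
  moreover have "{vector [A, 0], vector [B, 0], vector [A + g, h]} \<subseteq> range ?q"
    using rangeI[of ?q VA] rangeI[of ?q VB] rangeI[of ?q Va] by simp
  ultimately have "\<not> collinear (range ?q)"
    using collinear_subset by blast
  then have dim: "aff_dim (range ?q) = 2"
    using aff_dim_le_DIM[of "range ?q"] by (simp add: collinear_aff_dim)
  have ne: "?q i \<noteq> ?q j" if "{i, j} \<in> ladder_edges" for i j
    using that by (rule ladder_edges_induct) (use assms in \<open>simp_all add: neq\<close>)
  show ?thesis
    unfolding step_ladder_def
    using dim ne poles affine_parallel_translate[of "{?q VA, ?q VB, ?q VC}" "vector [g, h]"] rungs
    by (simp add: collinear_horizontal)
qed

text \<open>\<open>quad_A = 0\<close> says that the map from \<open>A, B, C\<close> to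
  \<open>a, b, c\<close> is affine. The discriminant is then the square of \<open>quad_B\<close>,
  whose vanishing makes the slope 1.\<close>

lemma translated_poles:
  assumes "A \<noteq> B" "A \<noteq> C" "B \<noteq> C" "a \<noteq> b"
    and "discriminant A B C a b c = 0" "quad_A A B C a b c = 0"
  shows "b = a - A + B \<and> c = a - A + C"
proof -
  have B: "quad_B A B C a b c = 0"
    using assms(5,6) by (simp add: discriminant_def)
  have "(C - A) * (b - a) * (b + C - (B + c)) = 0"
    using B assms(6) unfolding quad_A_def quad_B_def by algebra
  then have c: "c = b - B + C"
    using assms(2,4) by simp
  have "(C - B) * (b - B - (a - A)) = 0"
    using assms(6) unfolding quad_A_def c by algebra
  then show ?thesis
    using assms(3) c by simp
qed

lemma continuous_on_vector_2:
  fixes f g :: "'a::topological_space \<Rightarrow> real"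
  assumes "continuous_on S f" "continuous_on S g"
  shows "continuous_on S (\<lambda>x. vector [f x, g x] :: real ^ 2)"
proof -
  have "vector [f x, g x] = f x *\<^sub>R (vector [1, 0] :: real ^ 2) + g x *\<^sub>R vector [0, 1]" for x
    by (simp add: vec_eq_iff forall_2)
  then show ?thesis
    using assms by (auto intro!: continuous_intros)
qed

text \<open>The first pole stays fixed while the common rung vector, initially
  \<open>(g, 0)\<close>, turns by the angle \<open>t\<close>; the second pole remains a translate of
  the first.\<close>

lemma translated_ladder_flex:
  assumes "A \<noteq> B" "A \<noteq> C" "B \<noteq> C" "g \<noteq> 0"
  shows "\<not> universally_rigid ladder_edges (ladder_line A B C (g + A) (g + B) (g + C))" (is ?flexible)
    and "flexes_as_step_ladder (ladder_line A B C (g + A) (g + B) (g + C))" (is ?flex)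
proof -
  define \<gamma> :: "real \<Rightarrow> vertex \<Rightarrow> real ^ 2" where
    "\<gamma> t = ladder_config (vector [A, 0]) (vector [B, 0]) (vector [C, 0])
      (vector [A + g * cos t, g * sin t]) (vector [B + g * cos t, g * sin t])
      (vector [C + g * cos t, g * sin t])" for t
  let ?p = "ladder_line A B C (g + A) (g + B) (g + C)"
  have sqrt_rung: "sqrt ((g * cos t)\<^sup>2 + (g * sin t)\<^sup>2) = \<bar>g\<bar>" for t
    by (simp add: power_mult_distrib distrib_left[symmetric])
  have edge: "dist (\<gamma> t i) (\<gamma> t j) = dist (?p i) (?p j)" if "{i, j} \<in> ladder_edges" for t i j
    by (rule ladder_edges_induct[OF that]) (simp_all add: \<gamma>_def dist_vec2 sqrt_rung dist_commute)
  show ?flexible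
  proof
    assume "universally_rigid ladder_edges ?p"
    then have "dist (\<gamma> 1 VA) (\<gamma> 1 Vb) = dist (?p VA) (?p Vb)"
      by (rule universally_rigidD) (simp_all add: edge)
    then have "sqrt ((A - B - g * cos 1)\<^sup>2 + (g * sin 1)\<^sup>2) = sqrt ((A - B - g)\<^sup>2)"
      by (simp add: \<gamma>_def dist_vec2 algebra_simps)
    then have "(A - B - g * cos 1)\<^sup>2 + (g * sin 1)\<^sup>2 = (A - B - g)\<^sup>2"
      by (simp del: real_sqrt_abs)
    moreover have "(cos 1)\<^sup>2 + (sin 1)\<^sup>2 = (1 :: real)"
      by simp
    \<comment> \<open>Law of cosines for the diagonal from \<open>VA\<close> to
      \<open>Vb\<close>.\<close>
    ultimately have "2 * (A - B) * g * (1 - cos 1) = 0"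
      by algebra
    moreover have "cos 1 < cos (0 :: real)"
      by (rule cos_monotone_0_pi) (use pi_gt3 in auto)
    ultimately show False
      using assms by simp
  qed
  have "continuous_on {0..1} (\<lambda>t. \<gamma> t i)" for i
    by (cases i) (auto simp: \<gamma>_def intro!: continuous_intros continuous_on_vector_2)
  moreover have "\<gamma> 0 i = embed_plane (?p i)" for i
    by (cases i) (simp_all add: \<gamma>_def embed_plane_def add.commute)
  moreover have "step_ladder (\<gamma> t)" if "t \<in> {0<..1}" for t
  proof -
    have "sin t > 0"
      using that pi_gt3 by (intro sin_gt_zero) auto
    then show ?thesis
      unfolding \<gamma>_def using assms by (intro step_ladder_translated) auto
  qed
  ultimately show ?flex
    unfolding flexes_as_step_ladder_def using edge by blast
qed

section \<open>Super stability\<close>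

text \<open>Finsler's lemma: a form positive definite on the plane \<open>s = t = 0\<close> becomes
  positive definite after adding a large multiple of \<open>s\<^sup>2 + t\<^sup>2\<close>.\<close>

lemma finsler_two_two:
  fixes q1 q2 q3 l1 l2 m1 m2 e1 e2 e3 :: real
  assumes "q1 > 0" "q2\<^sup>2 < q1 * q3"
  obtains e T where "e > 0" "\<forall>x y s t. e * (x\<^sup>2 + y\<^sup>2 + s\<^sup>2 + t\<^sup>2) \<le>
      q1 * x\<^sup>2 + 2 * q2 * (x * y) + q3 * y\<^sup>2
      + 2 * l1 * (x * s) + 2 * l2 * (y * s) + 2 * m1 * (x * t) + 2 * m2 * (y * t)
      + e1 * s\<^sup>2 + 2 * e2 * (s * t) + e3 * t\<^sup>2 + T * (s\<^sup>2 + t\<^sup>2)"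
proof -
  have "q3 > 0"
    using assms by (metis less_le_trans linorder_not_less mult_le_0_iff not_less_iff_gr_or_eq zero_le_power2)
  \<comment> \<open>Determinant over trace, a lower bound for the smaller eigenvalue.\<close>
  define e where "e = (q1 * q3 - q2\<^sup>2) / (q1 + q3)"
  have e: "e > 0" "e * (q1 + q3) = q1 * q3 - q2\<^sup>2"
    using assms \<open>q3 > 0\<close> by (simp_all add: e_def)
  have "e * (q1 + q3) < q1 * (q1 + q3)"
    unfolding e(2) using assms(1) zero_le_power2[of q2] by (simp add: algebra_simps add_pos_nonneg power2_eq_square)
  then have "q1 > e"
    using assms(1) \<open>q3 > 0\<close> by simp
  have base: "e * (x\<^sup>2 + y\<^sup>2) \<le> q1 * x\<^sup>2 + 2 * q2 * (x * y) + q3 * y\<^sup>2" for x y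
  proof -
    have "(q1 - e) * (q1 * x\<^sup>2 + 2 * q2 * (x * y) + q3 * y\<^sup>2 - e * (x\<^sup>2 + y\<^sup>2)) =
        ((q1 - e) * x + q2 * y)\<^sup>2 + (e * y)\<^sup>2"
      using e(2) by algebra
    also have "\<dots> \<ge> 0" by simp
    finally show ?thesis
      using \<open>q1 > e\<close> by (simp add: zero_le_mult_iff)
  qed
  \<comment> \<open>Young's inequality. Each of \<open>x\<close> and \<open>y\<close> occurs in two
    cross terms, costing \<open>e / 4\<close> each, so \<open>e / 2\<close> survives.\<close>
  define K where "K k = 4 * k\<^sup>2 / e" for k
  have young: "- (e / 4 * x\<^sup>2 + K k * s\<^sup>2) \<le> 2 * k * (x * s)" for k x s
  proof -
    have "0 \<le> (e / 2 * x + 2 * k * s)\<^sup>2 / e"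
      using e(1) by simp
    also have "\<dots> = e / 4 * x\<^sup>2 + K k * s\<^sup>2 + 2 * k * (x * s)"
      using e(1) by (simp add: K_def power2_eq_square field_simps)
    finally show ?thesis by linarith
  qed
  have cross: "- \<bar>e2\<bar> * (s\<^sup>2 + t\<^sup>2) \<le> 2 * e2 * (s * t)" for s t
  proof -
    have "\<bar>2 * (s * t)\<bar> \<le> s\<^sup>2 + t\<^sup>2"
      using sum_squares_bound[of s t] sum_squares_bound[of s "- t"] by (simp add: abs_le_iff algebra_simps)
    then have "\<bar>e2\<bar> * \<bar>2 * (s * t)\<bar> \<le> \<bar>e2\<bar> * (s\<^sup>2 + t\<^sup>2)"
      by (intro mult_left_mono) auto
    then show ?thesis
      by (simp add: abs_mult[symmetric] abs_le_iff mult_ac)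
  qed
  define T where "T = K l1 + K l2 + K m1 + K m2 + \<bar>e1\<bar> + \<bar>e2\<bar> + \<bar>e3\<bar> + e / 2"
  show thesis
  proof (rule that[of "e / 2" T], goal_cases)
    case 1
    show ?case using e by simp
  next
    case 2
    show ?case
    proof (intro allI)
    fix x y s t :: real
    have "- \<bar>e1\<bar> * s\<^sup>2 \<le> e1 * s\<^sup>2" "- \<bar>e3\<bar> * t\<^sup>2 \<le> e3 * t\<^sup>2"
      by (intro mult_right_mono; simp)+
    moreover have "0 \<le> (K m1 + K m2 + \<bar>e3\<bar>) * s\<^sup>2" "0 \<le> (K l1 + K l2 + \<bar>e1\<bar>) * t\<^sup>2"
      using e(1) by (simp_all add: K_def)
    ultimately show "e / 2 * (x\<^sup>2 + y\<^sup>2 + s\<^sup>2 + t\<^sup>2) \<le>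
      q1 * x\<^sup>2 + 2 * q2 * (x * y) + q3 * y\<^sup>2
      + 2 * l1 * (x * s) + 2 * l2 * (y * s) + 2 * m1 * (x * t) + 2 * m2 * (y * t)
      + e1 * s\<^sup>2 + 2 * e2 * (s * t) + e3 * t\<^sup>2 + T * (s\<^sup>2 + t\<^sup>2)"
      using base[of x y] young[of x l1 s] young[of y l2 s] young[of x m1 t] young[of y m2 t] cross[of s t]
      unfolding T_def distrib_left distrib_right by linarith
    qed
  qed
qed

lemma binary_form_pos:
  fixes k l m :: real
  assumes "l\<^sup>2 - 4 * k * m > 0"
  obtains x y where "k * x\<^sup>2 + l * (x * y) + m * y\<^sup>2 > 0"
proof (cases "k = 0")
  case True
  with assms have "l \<noteq> 0" by auto
  then show thesis
    using True by (intro that[of "(1 - m) / l" 1]) simp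
next
  case False
  show thesis
  proof (cases "k > 0")
    case True
    then show thesis by (intro that[of 1 0]) simp
  next
    case False
    with \<open>k \<noteq> 0\<close> assms have "- k * (l\<^sup>2 - 4 * k * m) > 0"
      by (intro mult_pos_pos) auto
    \<comment> \<open>The ratio \<open>- l / (2 * k)\<close> is the vertex of the parabola.\<close>
    then show thesis
      by (intro that[of l "- 2 * k"]) (simp add: power2_eq_square algebra_simps)
  qed
qed

lemma independent_two:
  fixes x y :: "'a::real_vector"
  assumes "x \<noteq> 0" "y \<notin> span {x}"
  shows "independent {y, x}" "card {y, x} = 2"
  using assms span_base[of x "{x}"] by (auto simp: independent_insert card_insert_if)

definition ladder_stress ::
    "real \<Rightarrow> real \<Rightarrow> real \<Rightarrow> real \<Rightarrow> real \<Rightarrow> real \<Rightarrow> real \<Rightarrow> real \<Rightarrow> real \<Rightarrow> vertex \<Rightarrow> vertex \<Rightarrow> real" where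
  "ladder_stress wAB wBC wAC wab wbc wac p q r = ladder_config
    (ladder_config 0 wAB wAC p 0 0) (ladder_config wAB 0 wBC 0 q 0) (ladder_config wAC wBC 0 0 0 r)
    (ladder_config p 0 0 0 wab wac) (ladder_config 0 q 0 wab 0 wbc) (ladder_config 0 0 r wac wbc 0)"

lemma ladder_stress_commute:
  "ladder_stress wAB wBC wAC wab wbc wac p q r i j = ladder_stress wAB wBC wAC wab wbc wac p q r j i"
  unfolding ladder_stress_def by (cases i; cases j) simp_all

lemma ladder_stress_eq_0:
  assumes "{i, j} \<notin> ladder_edges"
  shows "ladder_stress wAB wBC wAC wab wbc wac p q r i j = 0"
  using assms unfolding ladder_stress_def ladder_edges_def
  by (cases i; cases j) (simp_all add: doubleton_eq_iff)

lemma inner_ladder_stress: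
  "x \<bullet> (stress_matrix (ladder_stress wAB wBC wAC wab wbc wac p q r) *v x) =
    wAB * (x $ VA - x $ VB)\<^sup>2 + wBC * (x $ VC - x $ VB)\<^sup>2 + wAC * (x $ VA - x $ VC)\<^sup>2
    + wab * (x $ Va - x $ Vb)\<^sup>2 + wbc * (x $ Vc - x $ Vb)\<^sup>2 + wac * (x $ Va - x $ Vc)\<^sup>2
    + p * (x $ VA - x $ Va)\<^sup>2 + q * (x $ VB - x $ Vb)\<^sup>2 + r * (x $ VC - x $ Vc)\<^sup>2"
  using inner_stress_matrix[of "ladder_stress wAB wBC wAC wab wbc wac p q r" x x, OF ladder_stress_commute]
  by (simp add: sum_UNIV_vertex ladder_stress_def power2_eq_square algebra_simps)

lemma nonconstant_notin_span_one:
  assumes "p $ i \<noteq> p $ j"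
  shows "p \<notin> span {1 :: real ^ 'n}"
  using assms by (auto simp: span_singleton)

text \<open>A second-order flex \<open>(g, h)\<close> exists. Pairing it with the stress gives zero
  energy for \<open>g\<close>, so \<open>g\<close> joins \<open>P\<close> and 1 in the kernel, while
  super stability allows only dimension two.\<close>

lemma not_super_stable_if_double_root:
  assumes "A \<noteq> B" "a \<noteq> b"
    and "discriminant A B C a b c = 0" "quad_A A B C a b c \<noteq> 0"
  shows "\<not> super_stable ladder_edges (ladder_line A B C a b c)"
proof
  assume "super_stable ladder_edges (ladder_line A B C a b c)"
  then obtain \<omega> where stress: "equilibrium_stress ladder_edges (ladder_line A B C a b c) \<omega>"
    and psd: "positive_semidefinite (stress_matrix \<omega>)"
    and rank: "rank (stress_matrix \<omega>) + CARD(1) + 1 = CARD(vertex)"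
    unfolding super_stable_def by blast
  define M where "M = stress_matrix \<omega>"
  define P where "P = (\<chi> i. ladder_line A B C a b c i $ 1)"
  have sym: "\<omega> i j = \<omega> j i" and zero: "{i, j} \<notin> ladder_edges \<Longrightarrow> \<omega> i j = 0" for i j
    using stress by (auto simp: equilibrium_stress_line)
  have P: "M *v P = 0"
    using stress by (simp add: equilibrium_stress_line M_def P_def)
  obtain r y where r: "(A - r)\<^sup>2 + (A - a) * (2 * y - A) = 0"
    "(B - r)\<^sup>2 + (B - b) * (2 * y - B) = 0"
    "(C - r)\<^sup>2 + (C - c) * (2 * y - C) = 0"
    using rung_relation_double_root[OF assms(3,4)] by metis
  \<comment> \<open>\<open>g\<close> is a transverse motion rotating the first pole about \<open>r\<close>; \<open>h\<close> corrects the edge lengths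
    along the line to second order.\<close>
  define g where "g = (\<chi> i. ladder_config (A - r) (B - r) (C - r) 0 0 0 i)"
  define h where "h = (\<chi> i. ladder_config (2 * y - A) (2 * y - B) (2 * y - C) 0 0 0 i)"
  have "(g $ i - g $ j) * (g $ i - g $ j) + (h $ i - h $ j) * (P $ i - P $ j) = 0"
    if "{i, j} \<in> ladder_edges" for i j
    by (rule ladder_edges_induct[OF that])
      (use r in \<open>auto simp: g_def h_def P_def power2_eq_square algebra_simps\<close>)
  then have "\<omega> i j * ((g $ i - g $ j) * (g $ i - g $ j)) + \<omega> i j * ((h $ i - h $ j) * (P $ i - P $ j)) = 0"
    for i j
    using zero[of i j] unfolding distrib_left[symmetric] by fastforce
  then have "2 * (g \<bullet> (M *v g)) + 2 * (h \<bullet> (M *v P)) = 0"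
    unfolding M_def inner_stress_matrix[OF sym] by (simp add: sum.distrib[symmetric])
  then have "g \<bullet> (M *v g) = 0"
    by (simp add: P)
  then have g: "M *v g = 0"
    using psd unfolding M_def by (intro positive_semidefinite_kernel)
  have one: "M *v 1 = 0"
    by (simp add: M_def vec_eq_iff stress_matrix_vector_nth)
  have "P \<notin> span {1}"
    by (rule nonconstant_notin_span_one[of _ VA VB]) (use assms in \<open>simp add: P_def\<close>)
  note PI = independent_two[OF one_neq_zero this]
  \<comment> \<open>An affine function of position vanishing on the second pole is zero, but
    \<open>g\<close> differs at \<open>VA\<close> and \<open>VB\<close>.\<close>
  have "g \<notin> span {P, 1}"
  proof
    assume "g \<in> span {P, 1}"
    then obtain s t where "g = s *\<^sub>R P + t *\<^sub>R 1"
      unfolding mem_span_two_iff by blast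
    then have "A - r = s * A + t" "B - r = s * B + t" "0 = s * a + t" "0 = s * b + t"
      unfolding vec_eq_iff by (auto simp: g_def P_def dest: spec[of _ VA] spec[of _ VB] spec[of _ Va] spec[of _ Vb])
    then have "s * (a - b) = 0" "A - B = s * (A - B)"
      by algebra+
    with assms(1,2) show False
      by simp
  qed
  then have "independent {g, P, 1}" "card {g, P, 1} = 3"
    using PI span_base[of g "{P, 1}"] by (auto simp: independent_insert card_insert_if)
  then have "3 \<le> dim {x. M *v x = 0}"
    using independent_card_le_dim[of "{g, P, 1}" "{x. M *v x = 0}"] P g one by simp
  then show False
    using dim_kernel_plus_rank[of M] rank by (simp add: M_def)
qed

section \<open>Positive discriminant: a semidefinite stress of corank two\<close>

text \<open>The stress balances forces \<open>f\<close>, \<open>g\<close> at the vertices with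
  offsets \<alpha>, \<beta> from the third. For \<open>f = g = 0\<close> it is the self-stress of a
  collinear triangle, whose energy is \<open>T\<close> times the squared difference of the slopes
  \<open>x\<close>, \<open>y\<close>.\<close>

lemma triangle_stress:
  fixes \<alpha> \<beta> f g T :: real
  assumes "\<alpha> \<noteq> 0" "\<beta> \<noteq> 0"
  obtains w1 w2 w3 S where
    "w1 * \<alpha> = S - f" "w2 * \<beta> = - S - g" "w3 * (\<alpha> - \<beta>) = - S"
    "\<forall>x y. w1 * (\<alpha> * x)\<^sup>2 + w2 * (\<beta> * y)\<^sup>2 + w3 * (\<alpha> * x - \<beta> * y)\<^sup>2 =
      T * (y - x)\<^sup>2 - f * \<alpha> * x\<^sup>2 - g * \<beta> * y\<^sup>2"
proof -
  define w3 where "w3 = T / (\<alpha> * \<beta>)"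
  define S where "S = w3 * (\<beta> - \<alpha>)"
  define w1 where "w1 = (S - f) / \<alpha>"
  define w2 where "w2 = (- S - g) / \<beta>"
  have w: "w1 * \<alpha> = S - f" "w2 * \<beta> = - S - g" "w3 * \<alpha> * \<beta> = T"
    using assms by (simp_all add: w1_def w2_def w3_def)
  show thesis
  proof (rule that[OF w(1,2)])
    show "w3 * (\<alpha> - \<beta>) = - S"
      by (simp add: S_def algebra_simps)
    show "\<forall>x y. w1 * (\<alpha> * x)\<^sup>2 + w2 * (\<beta> * y)\<^sup>2 + w3 * (\<alpha> * x - \<beta> * y)\<^sup>2 =
      T * (y - x)\<^sup>2 - f * \<alpha> * x\<^sup>2 - g * \<beta> * y\<^sup>2"
      using w S_def by (intro allI) algebra
  qed
qed

text \<open>The variables \<open>x, y, u, v\<close> are slopes of a vertex function along the four pole edges at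
  \<open>B\<close> and \<open>b\<close>. The load condition makes the energy invariant under adding a common slope, so only
  differences occur on the right.\<close>

lemma ladder_energy:
  fixes p q r :: real
  assumes "p * ka + q * kb + r * kc = 0" "ka = kb + \<alpha> - \<alpha>'" "kc = kb + \<beta> - \<beta>'"
  shows "(T * (y - x)\<^sup>2 - p * ka * \<alpha> * x\<^sup>2 - r * kc * \<beta> * y\<^sup>2)
      + (T * (v - u)\<^sup>2 - (- p * ka) * \<alpha>' * u\<^sup>2 - (- r * kc) * \<beta>' * v\<^sup>2)
      + p * (w + u * kb + \<alpha> * x - \<alpha>' * u)\<^sup>2 + q * (w + u * kb)\<^sup>2
      + r * (w + u * kb + \<beta> * y - \<beta>' * v)\<^sup>2 =
    (p + q + r) * w\<^sup>2 + 2 * (p * \<alpha> + r * \<beta>) * (w * (x - u))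
      + (p * \<alpha> * (\<alpha> - ka) + r * \<beta> * (\<beta> - kc)) * (x - u)\<^sup>2
      + 2 * (r * \<beta>) * (w * (y - x)) + 2 * (r * \<beta> * (\<beta> - kc)) * ((x - u) * (y - x))
      + 2 * (- r * \<beta>') * (w * (v - u)) + 2 * (- r * \<beta> * \<beta>') * ((x - u) * (v - u))
      + (r * \<beta> * (\<beta> - kc)) * (y - x)\<^sup>2 + 2 * (- r * \<beta> * \<beta>') * ((y - x) * (v - u))
      + (r * \<beta>' * (\<beta>' + kc)) * (v - u)\<^sup>2 + T * ((y - x)\<^sup>2 + (v - u)\<^sup>2)"
    (is "?L = ?R")
proof -
  have "?L - ?R = (p * ka + q * kb + r * kc) * (2 * w * u + kb * u\<^sup>2)"
    unfolding assms(2,3) by (simp add: power2_eq_square algebra_simps)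
  then show ?thesis
    by (simp add: assms(1))
qed

text \<open>The left-hand side is the discriminant of the second quadratic form in
  \<open>super_stable_if_rung_stress\<close>, restricted to the plane of rung stresses satisfying the
  load condition.\<close>

lemma discriminant_alt:
  "((C - c) * ((A - B) * (a - b)) - (A - a) * ((B - C) * (b - c)) - (B - b) * ((A - C) * (a - c)))\<^sup>2
    - 4 * ((A - a) * (B - b) * ((A - C) * (a - c)) * ((B - C) * (b - c))) = discriminant A B C a b c"
  unfolding discriminant_def quad_A_def quad_B_def quad_C_def
  by (simp add: power2_eq_square algebra_simps)

text \<open>The conditions \<open>pos\<close> make the rung stress positive definite on functions
  affine along each pole, modulo globally affine ones. Finsler's lemma supplies \<open>T\<close>,
  and the triangle self-stresses realise it.\<close>

lemma super_stable_if_rung_stress: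
  assumes "A \<noteq> B" "B \<noteq> C" "a \<noteq> b" "b \<noteq> c"
    and load: "p * (A - a) + q * (B - b) + r * (C - c) = 0"
    and pos: "p + q + r > 0"
      "p * q * ((A - B) * (a - b)) + q * r * ((B - C) * (b - c)) + p * r * ((A - C) * (a - c)) > 0"
  shows "super_stable ladder_edges (ladder_line A B C a b c)"
proof -
  define ka kb kc where "ka = A - a" "kb = B - b" "kc = C - c"
  define \<alpha> \<beta> \<alpha>' \<beta>' where "\<alpha> = A - B" "\<beta> = C - B" "\<alpha>' = a - b" "\<beta>' = c - b"
  note defs = ka_kb_kc_def \<alpha>_\<beta>_\<alpha>'_\<beta>'_def
  have nz: "\<alpha> \<noteq> 0" "\<beta> \<noteq> 0" "\<alpha>' \<noteq> 0" "\<beta>' \<noteq> 0"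
    using assms(1-4) by (simp_all add: defs)
  have load: "p * ka + q * kb + r * kc = 0" and ka: "ka = kb + \<alpha> - \<alpha>'" and kc: "kc = kb + \<beta> - \<beta>'"
    using load by (simp_all add: defs)
  \<comment> \<open>The coefficient of \<open>(x - u)\<^sup>2\<close> in
    \<open>ladder_energy\<close>. The second condition in \<open>pos\<close> is the determinant of
    the binary form with entries \<open>p + q + r\<close>,
    \<open>p * \<alpha> + r * \<beta>\<close>, \<open>m\<close>.\<close>
  define m where "m = p * \<alpha> * (\<alpha> - ka) + r * \<beta> * (\<beta> - kc)"
  have "(p + q + r) * m - (p * \<alpha> + r * \<beta>)\<^sup>2 =
      p * q * (\<alpha> * \<alpha>') + q * r * (\<beta> * \<beta>') + p * r * ((\<alpha> - \<beta>) * (\<alpha>' - \<beta>'))"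
    using load unfolding m_def ka kc by algebra
  also have "\<dots> > 0"
    using pos(2) by (simp add: defs algebra_simps)
  finally have "(p * \<alpha> + r * \<beta>)\<^sup>2 < (p + q + r) * m"
    by simp
  with pos(1) obtain e T where "e > 0" and T: "\<forall>x y s t. e * (x\<^sup>2 + y\<^sup>2 + s\<^sup>2 + t\<^sup>2) \<le>
      (p + q + r) * x\<^sup>2 + 2 * (p * \<alpha> + r * \<beta>) * (x * y) + m * y\<^sup>2
      + 2 * (r * \<beta>) * (x * s) + 2 * (r * \<beta> * (\<beta> - kc)) * (y * s)
      + 2 * (- r * \<beta>') * (x * t) + 2 * (- r * \<beta> * \<beta>') * (y * t)
      + (r * \<beta> * (\<beta> - kc)) * s\<^sup>2 + 2 * (- r * \<beta> * \<beta>') * (s * t)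
      + (r * \<beta>' * (\<beta>' + kc)) * t\<^sup>2 + T * (s\<^sup>2 + t\<^sup>2)"
    by (rule finsler_two_two[of "p + q + r" "p * \<alpha> + r * \<beta>" m "r * \<beta>" "r * \<beta> * (\<beta> - kc)"
          "- r * \<beta>'" "- r * \<beta> * \<beta>'" "r * \<beta> * (\<beta> - kc)" "- r * \<beta> * \<beta>'"
          "r * \<beta>' * (\<beta>' + kc)"])
  \<comment> \<open>The rungs exert \<open>p * ka\<close> and \<open>r * kc\<close> on the first
    pole and the opposite forces on the second; balance at \<open>B\<close> and \<open>b\<close>
    follows from \<open>load\<close>.\<close>
  obtain wAB wBC wAC S where w: "wAB * \<alpha> = S - p * ka" "wBC * \<beta> = - S - r * kc" "wAC * (\<alpha> - \<beta>) = - S"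
    and W: "\<forall>x y. wAB * (\<alpha> * x)\<^sup>2 + wBC * (\<beta> * y)\<^sup>2 + wAC * (\<alpha> * x - \<beta> * y)\<^sup>2 =
      T * (y - x)\<^sup>2 - p * ka * \<alpha> * x\<^sup>2 - r * kc * \<beta> * y\<^sup>2"
    by (rule triangle_stress[OF nz(1,2)])
  obtain wab wbc wac S' where w': "wab * \<alpha>' = S' - (- p * ka)" "wbc * \<beta>' = - S' - (- r * kc)"
      "wac * (\<alpha>' - \<beta>') = - S'"
    and W': "\<forall>x y. wab * (\<alpha>' * x)\<^sup>2 + wbc * (\<beta>' * y)\<^sup>2 + wac * (\<alpha>' * x - \<beta>' * y)\<^sup>2 =
      T * (y - x)\<^sup>2 - (- p * ka) * \<alpha>' * x\<^sup>2 - (- r * kc) * \<beta>' * y\<^sup>2"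
    by (rule triangle_stress[OF nz(3,4)])
  define \<omega> where "\<omega> = ladder_stress wAB wBC wAC wab wbc wac p q r"
  define M where "M = stress_matrix \<omega>"
  define P where "P = (\<chi> i. ladder_line A B C a b c i $ 1)"
  have P: "P $ VA = B + \<alpha>" "P $ VB = B" "P $ VC = B + \<beta>"
    "P $ Va = b + \<alpha>'" "P $ Vb = b" "P $ Vc = b + \<beta>'"
    by (simp_all add: P_def defs)
  have "(M *v P) $ i = 0" for i
    using w w' load unfolding M_def stress_matrix_vector_nth
    by (cases i)
      (simp_all add: sum_UNIV_vertex \<omega>_def ladder_stress_def P, simp_all add: defs algebra_simps)
  then have MP: "M *v P = 0"
    by (simp add: vec_eq_iff)
  \<comment> \<open>\<open>z\<close> is the defect of rung \<open>B\<close> from a global slope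
    \<open>u\<close>. All four squares vanish exactly when \<open>f\<close> is an affine function of
    position.\<close>
  have energy: "e * (z\<^sup>2 + (x - u)\<^sup>2 + (y - x)\<^sup>2 + (v - u)\<^sup>2) \<le> f \<bullet> (M *v f)"
    if f: "f $ VA - f $ VB = \<alpha> * x" "f $ VC - f $ VB = \<beta> * y" "f $ Va - f $ Vb = \<alpha>' * u"
      "f $ Vc - f $ Vb = \<beta>' * v" "f $ VB - f $ Vb = z + u * kb" for f x y u v z
  proof -
    have f': "f $ VA - f $ VC = \<alpha> * x - \<beta> * y" "f $ Va - f $ Vc = \<alpha>' * u - \<beta>' * v"
      "f $ VA - f $ Va = z + u * kb + \<alpha> * x - \<alpha>' * u"
      "f $ VC - f $ Vc = z + u * kb + \<beta> * y - \<beta>' * v"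
      using f by linarith+
    have "f \<bullet> (M *v f) = (T * (y - x)\<^sup>2 - p * ka * \<alpha> * x\<^sup>2 - r * kc * \<beta> * y\<^sup>2)
      + (T * (v - u)\<^sup>2 - (- p * ka) * \<alpha>' * u\<^sup>2 - (- r * kc) * \<beta>' * v\<^sup>2)
      + p * (z + u * kb + \<alpha> * x - \<alpha>' * u)\<^sup>2 + q * (z + u * kb)\<^sup>2
      + r * (z + u * kb + \<beta> * y - \<beta>' * v)\<^sup>2"
      unfolding M_def \<omega>_def inner_ladder_stress f f' W[rule_format, symmetric] W'[rule_format, symmetric] by linarith
    then show ?thesis
      unfolding ladder_energy[OF load ka kc] m_def[symmetric] using T by simp
  qed
  have slopes: "\<exists>x y u v z. f $ VA - f $ VB = \<alpha> * x \<and> f $ VC - f $ VB = \<beta> * y \<and>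
      f $ Va - f $ Vb = \<alpha>' * u \<and> f $ Vc - f $ Vb = \<beta>' * v \<and> f $ VB - f $ Vb = z + u * kb" for f
    using nz
    by (intro exI[of _ "(f $ VA - f $ VB) / \<alpha>"] exI[of _ "(f $ VC - f $ VB) / \<beta>"]
        exI[of _ "(f $ Va - f $ Vb) / \<alpha>'"] exI[of _ "(f $ Vc - f $ Vb) / \<beta>'"]
        exI[of _ "f $ VB - f $ Vb - (f $ Va - f $ Vb) / \<alpha>' * kb"]) simp
  have "0 \<le> f \<bullet> (M *v f)" for f
  proof -
    obtain x y u v z where "f $ VA - f $ VB = \<alpha> * x" "f $ VC - f $ VB = \<beta> * y" "f $ Va - f $ Vb = \<alpha>' * u"
      "f $ Vc - f $ Vb = \<beta>' * v" "f $ VB - f $ Vb = z + u * kb"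
      using slopes by blast
    from energy[OF this] show ?thesis
      using \<open>e > 0\<close> by (smt (verit, best) mult_nonneg_nonneg zero_le_power2)
  qed
  then have psd: "positive_semidefinite M"
    unfolding positive_semidefinite_def M_def \<omega>_def
    by (simp add: transpose_stress_matrix[OF ladder_stress_commute])
  have kernel: "{f. M *v f = 0} = span {P, 1}"
  proof (intro subset_antisym subsetI)
    fix f assume "f \<in> {f. M *v f = 0}"
    then have 0: "M *v f = 0" by simp
    obtain x y u v z where f: "f $ VA - f $ VB = \<alpha> * x" "f $ VC - f $ VB = \<beta> * y" "f $ Va - f $ Vb = \<alpha>' * u"
      "f $ Vc - f $ Vb = \<beta>' * v" "f $ VB - f $ Vb = z + u * kb"
      using slopes by blast
    from energy[OF this] 0 \<open>e > 0\<close> have "z\<^sup>2 + (x - u)\<^sup>2 + (y - x)\<^sup>2 + (v - u)\<^sup>2 \<le> 0"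
      by (simp add: mult_le_0_iff)
    then have "z\<^sup>2 = 0" "(x - u)\<^sup>2 = 0" "(y - x)\<^sup>2 = 0" "(v - u)\<^sup>2 = 0"
      using zero_le_power2[of z] zero_le_power2[of "x - u"] zero_le_power2[of "y - x"] zero_le_power2[of "v - u"]
      by linarith+
    then have eq: "z = 0" "x = u" "y = u" "v = u"
      by simp_all
    have "f $ i = (u *\<^sub>R P + (f $ Vb - u * b) *\<^sub>R 1) $ i" for i
      using f unfolding eq by (cases i) (simp_all add: P defs algebra_simps)
    then show "f \<in> span {P, 1}"
      unfolding mem_span_two_iff vec_eq_iff by blast
  next
    fix f assume "f \<in> span {P, 1}"
    then obtain s t where "f = s *\<^sub>R P + t *\<^sub>R 1"
      unfolding mem_span_two_iff by blast
    moreover have "M *v 1 = 0"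
      by (simp add: M_def vec_eq_iff stress_matrix_vector_nth)
    ultimately show "f \<in> {f. M *v f = 0}"
      using MP by (simp add: matrix_vector_right_distrib matrix_vector_mult_scaleR)
  qed
  have "P \<notin> span {1}"
    by (rule nonconstant_notin_span_one[of _ VA VB]) (use nz in \<open>simp add: P\<close>)
  note PI = independent_two[OF one_neq_zero this]
  have "dim {f. M *v f = 0} = 2"
    unfolding kernel using dim_span_eq_card_independent[OF PI(1)] PI(2) by simp
  moreover have "CARD(vertex) = 6"
    by (simp add: UNIV_vertex)
  ultimately have rank: "rank M + CARD(1) + 1 = CARD(vertex)"
    using dim_kernel_plus_rank[of M] by simp
  have "equilibrium_stress ladder_edges (ladder_line A B C a b c) \<omega>"
    using MP ladder_stress_commute ladder_stress_eq_0
    by (simp add: equilibrium_stress_line M_def P_def \<omega>_def)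
  moreover have "\<not> on_conic_at_infinity ladder_edges (ladder_line A B C a b c)"
  proof
    assume "on_conic_at_infinity ladder_edges (ladder_line A B C a b c)"
    then obtain Q :: "real ^ 1 ^ 1" where "Q \<noteq> 0"
      and "(line_point A - line_point B) \<bullet> (Q *v (line_point A - line_point B)) = 0"
      unfolding on_conic_at_infinity_def using ladder_edges_mem(1) by fastforce
    then have "(A - B) * (Q $ 1 $ 1 * (A - B)) = 0"
      by (simp add: inner_vec_def matrix_vector_mult_def)
    then have "Q = 0"
      using assms(1) by (simp add: vec_eq_iff forall_1)
    with \<open>Q \<noteq> 0\<close> show False ..
  qed
  ultimately show ?thesis
    unfolding super_stable_def using psd rank unfolding M_def by blast
qed

text \<open>The rung stresses satisfying the load condition form a plane, parametrised by
  \<open>x\<close>, \<open>y\<close>. There the second form of \<open>pos\<close> is binary with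
  discriminant \<open>(C - c)\<^sup>2\<close> times the given one, so it takes a positive
  value.\<close>

lemma super_stable_if_discriminant_pos:
  assumes "A \<noteq> B" "B \<noteq> C" "a \<noteq> b" "b \<noteq> c" "C \<noteq> c" "discriminant A B C a b c > 0"
  shows "super_stable ladder_edges (ladder_line A B C a b c)"
proof -
  define PAB PBC PAC where "PAB = (A - B) * (a - b)" "PBC = (B - C) * (b - c)" "PAC = (A - C) * (a - c)"
  define k l m where "k = - (C - c) * (A - a) * PAC"
    "l = (C - c) * ((C - c) * PAB - (A - a) * PBC - (B - b) * PAC)"
    "m = - (C - c) * (B - b) * PBC"
  have "l\<^sup>2 - 4 * k * m = (C - c)\<^sup>2 * discriminant A B C a b c"
    unfolding discriminant_alt[symmetric] k_l_m_def PAB_PBC_PAC_def[symmetric] by algebra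
  then have "l\<^sup>2 - 4 * k * m > 0"
    using assms by simp
  then obtain x y where xy: "k * x\<^sup>2 + l * (x * y) + m * y\<^sup>2 > 0"
    by (rule binary_form_pos)
  define p q r where "p = (C - c) * x" "q = (C - c) * y" "r = - ((A - a) * x + (B - b) * y)"
  have load: "p * (A - a) + q * (B - b) + r * (C - c) = 0"
    unfolding p_q_r_def by algebra
  have N: "p * q * PAB + q * r * PBC + p * r * PAC =
      k * x\<^sup>2 + l * (x * y) + m * y\<^sup>2"
    unfolding k_l_m_def p_q_r_def by algebra
  \<comment> \<open>With zero sum and the load condition the form would be minus a square.\<close>
  have "p + q + r \<noteq> 0"
  proof
    assume "p + q + r = 0"
    with load have "p * q * PAB + q * r * PBC + p * r * PAC =
        - (p * (A - B) + r * (C - B))\<^sup>2"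
      unfolding PAB_PBC_PAC_def by algebra
    with xy N zero_le_power2[of "p * (A - B) + r * (C - B)"] show False
      by linarith
  qed
  \<comment> \<open>Negating all three rung stresses keeps the load condition and the quadratic
    form.\<close>
  then consider "p + q + r > 0" | "- p + - q + - r > 0" by linarith
  then show ?thesis
  proof cases
    case 1
    then show ?thesis
      using super_stable_if_rung_stress[OF assms(1-4) load] xy N by (simp add: PAB_PBC_PAC_def)
  next
    case 2
    show ?thesis
      by (rule super_stable_if_rung_stress[OF assms(1-4) _ 2]) (use load xy N in \<open>simp_all add: PAB_PBC_PAC_def algebra_simps\<close>)
  qed
qed

theorem theorem9p5:
  fixes A B C a b c :: real
  assumes "distinct [A, B, C]"
    and "distinct [a, b, c]"
    and "A \<noteq> a" and "B \<noteq> b" and "C \<noteq> c"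
  shows "(discriminant A B C a b c > 0 \<longrightarrow>
       super_stable ladder_edges (ladder_line A B C a b c)) \<and>
    (discriminant A B C a b c < 0 \<longrightarrow>
       \<not> universally_rigid ladder_edges (ladder_line A B C a b c)) \<and>
    (discriminant A B C a b c = 0 \<and> quad_A A B C a b c \<noteq> 0 \<longrightarrow>
       universally_rigid ladder_edges (ladder_line A B C a b c) \<and>
       \<not> super_stable ladder_edges (ladder_line A B C a b c)) \<and>
    (discriminant A B C a b c = 0 \<and> quad_A A B C a b c = 0 \<longrightarrow>
       \<not> universally_rigid ladder_edges (ladder_line A B C a b c) \<and>
       flexes_as_step_ladder (ladder_line A B C a b c))"
proof (intro conjI impI)
  show "super_stable ladder_edges (ladder_line A B C a b c)" if "discriminant A B C a b c > 0"
    using assms that by (intro super_stable_if_discriminant_pos) auto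
  show "\<not> universally_rigid ladder_edges (ladder_line A B C a b c)" if "discriminant A B C a b c < 0"
    using assms that by (intro not_universally_rigid_if_discriminant_neg) auto
  {
    assume "discriminant A B C a b c = 0 \<and> quad_A A B C a b c \<noteq> 0"
    with assms show "universally_rigid ladder_edges (ladder_line A B C a b c)"
      "\<not> super_stable ladder_edges (ladder_line A B C a b c)"
      by (auto intro!: universally_rigid_if_double_root dest: not_super_stable_if_double_root[rotated 2])
  }
  {
    assume "discriminant A B C a b c = 0 \<and> quad_A A B C a b c = 0"
    then have "b = a - A + B" "c = a - A + C"
      using translated_poles[of A B C a b c] assms by auto
    then show "\<not> universally_rigid ladder_edges (ladder_line A B C a b c)"
      "flexes_as_step_ladder (ladder_line A B C a b c)"
      using translated_ladder_flex[of A B C "a - A"] assms by simp_all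
  }
qed

end
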